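(* Let $n\ge 1$, let $\mu$ be Lebesgue measure on $\mathbb{R}$ and $\mu^n$ Lebesgue measure on $\mathbb{R}^n$, and equip $\mathbb{R}^n$ with the Hamming metric $d_{\mathrm{Ham}}$. Then $(\mathbb{R}^n,d_{\mathrm{Ham}})$ is $\Psi$-dominated with respect to $\mu$; that is, for all $f\in L_1(\mathbb{R}^n,\mu^n)$ and all $g\in\Phi_n$, $$\int_{\mathbb{R}^n} f(x)g(x)\,d\mu^n(x)\;\le\;\Psi_n(f).$$
   Context: Hamming metric: $d_{\mathrm{Ham}}(x,y)=\sum_{i=1}^n \mathbf{1}\{x_i\ne y_i\}$ for $x,y\in\mathbb{R}^n$; its diameter is $n$. $\Phi_n$ is the set of all measurable functions $g:\mathbb{R}^n\to[0,n]$ with Lipschitz constant at most $1$ with respect to $d_{\mathrm{Ham}}$, i.e. $|g(x)-g(y)|\le d_{\mathrm{Ham}}(x,y)$ for all $x,y\in\mathbb{R}^n$. Write $z_+=\max(z,0)$. For $k\ge1$ the projection operator $\pi:L_1(\mathbb{R}^k,\mu^k)\to L_1(\mathbb{R}^{k-1},\mu^{k-1})$ is $(\pi f)(x_2,\ldots,x_k)=\int_{\mathbb{R}} f(x_1,x_2,\ldots,x_k)\,d\mu(x_1)$. The functionals $\Psi_k:L_1(\mathbb{R}^k,\mu^k)\to\mathbb{R}$ are defined recursively by $\Psi_0=0$ and $$\Psi_k(f)=\Psi_{k-1}(\pi f)+\int_{\mathbb{R}^k}\big(f(x)\big)_+\,d\mu^k(x),\qquad k\ge1.$$ *)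

theory Defs
  imports "HOL-Analysis.Analysis"
begin

(* Points of R^n are the extensional functions on {..<n}; the paper's x_(i+1) is "x i".
   The product of Borel-Lebesgue measures is completed to obtain Lebesgue measure on R^n,
   so measurability and integrability below are in the (more general) Lebesgue sense. *)
definition leb_pow :: "nat \<Rightarrow> (nat \<Rightarrow> real) measure" where
  "leb_pow n = completion (Pi\<^sub>M {..<n} (\<lambda>_. lborel))"

definition hamming_dist :: "nat \<Rightarrow> (nat \<Rightarrow> real) \<Rightarrow> (nat \<Rightarrow> real) \<Rightarrow> real" where
  "hamming_dist n x y = (\<Sum>i<n. if x i \<noteq> y i then 1 else 0)"

definition Phi :: "nat \<Rightarrow> ((nat \<Rightarrow> real) \<Rightarrow> real) set" where
  "Phi n = {g. g \<in> borel_measurable (leb_pow n) \<and>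
     (\<forall>x\<in>space (leb_pow n). g x \<in> {0..real n}) \<and>
     (\<forall>x\<in>space (leb_pow n). \<forall>y\<in>space (leb_pow n). \<bar>g x - g y\<bar> \<le> hamming_dist n x y)}"

(* "case_nat t x" is the tuple (t, x 0, x 1, ...); it maps extensional functions on {..<k}
   to extensional functions on {..<Suc k}. For Lebesgue integrable f the section is
   integrable for almost every x; elsewhere the integral takes the default value 0. *)
definition proj_first :: "((nat \<Rightarrow> real) \<Rightarrow> real) \<Rightarrow> (nat \<Rightarrow> real) \<Rightarrow> real" where
  "proj_first f x = (\<integral>t. f (case_nat t x) \<partial>lebesgue)"

primrec Psi :: "nat \<Rightarrow> ((nat \<Rightarrow> real) \<Rightarrow> real) \<Rightarrow> real" where
  "Psi 0 f = 0"
| "Psi (Suc k) f = Psi k (proj_first f) + (\<integral>x. max (f x) 0 \<partial>leb_pow (Suc k))"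

end

theory Submission
  imports Defs
begin

text \<open>
  Induction on \<open>n\<close>, peeling off the first coordinate. Let \<open>s x\<close> be the essential supremum of
  \<open>t \<mapsto> g (t, x)\<close> and \<open>h = max (s - 1) 0\<close>. Then \<open>h \<in> \<Phi>\<^sub>k\<close> whenever \<open>g \<in> \<Phi>\<^bsub>k+1\<^esub>\<close>, and since \<open>g\<close> varies by
  at most 1 in its first coordinate, \<open>0 \<le> g (t, x) - h x \<le> 1\<close> for almost every \<open>t\<close>. Hence
  \<open>f g \<le> f h + f\<^sub>+\<close> almost everywhere, and by Fubini the integral of \<open>f h\<close> is that of \<open>(\<pi> f) h\<close>,
  which the induction hypothesis bounds by \<open>\<Psi>\<^sub>k (\<pi> f)\<close>. The ordinary supremum would not do, as it
  need not be measurable.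
\<close>

section \<open>Splitting off the first coordinate\<close>

abbreviation lborel_pow :: "nat \<Rightarrow> (nat \<Rightarrow> real) measure" where
  "lborel_pow n \<equiv> Pi\<^sub>M {..<n} (\<lambda>_. lborel)"

interpretation lborel_product: product_sigma_finite "\<lambda>_::nat. lborel :: real measure"
  by standard

lemma sigma_finite_lborel_pow: "sigma_finite_measure (lborel_pow n)"
  by (rule lborel_product.sigma_finite) simp

lemma pair_sigma_finite_lborel_pow: "pair_sigma_finite (lborel_pow n) (lborel :: real measure)"
  by (intro pair_sigma_finite.intro sigma_finite_lborel_pow lborel.sigma_finite_measure_axioms)

lemma case_nat_in_space:
  assumes "x \<in> space (lborel_pow k)"
  shows "case_nat t x \<in> space (lborel_pow (Suc k))"
  using assms by (auto simp: space_PiM PiE_iff extensional_def split: nat.split)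

lemma measurable_case_nat_lborel_pow [measurable]:
  "(\<lambda>(x, t). case_nat t x) \<in> lborel_pow k \<Otimes>\<^sub>M lborel \<rightarrow>\<^sub>M lborel_pow (Suc k)"
proof (rule measurable_PiM_single')
  fix i assume "i \<in> {..<Suc k}"
  then show "(\<lambda>p. (case p of (x, t) \<Rightarrow> case_nat t x) i) \<in> lborel_pow k \<Otimes>\<^sub>M lborel \<rightarrow>\<^sub>M lborel"
    by (cases i) (auto simp: case_prod_beta intro!: measurable_compose[OF measurable_fst] measurable_component_singleton)
next
  show "(\<lambda>(x, t). case_nat t x) \<in> space (lborel_pow k \<Otimes>\<^sub>M lborel) \<rightarrow> (\<Pi>\<^sub>E i\<in>{..<Suc k}. space lborel)"
    using case_nat_in_space[of _ k] by (auto simp: space_pair_measure space_PiM)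
qed

lemma measurable_tail_lborel_pow [measurable]:
  "(\<lambda>z. z \<circ> Suc) \<in> lborel_pow (Suc k) \<rightarrow>\<^sub>M lborel_pow k"
  by (rule measurable_PiM_single') (auto simp: space_PiM PiE_iff extensional_def)

text \<open>Product measures are determined by their values on boxes, and a box pulls back to a
  rectangle. This identity carries Fubini from the pair product to powers; the tail is the first
  factor so that the first coordinate \<open>t\<close> becomes the inner variable.\<close>

lemma distr_case_nat_lborel_pow:
  "distr (lborel_pow k \<Otimes>\<^sub>M lborel) (lborel_pow (Suc k)) (\<lambda>(x, t). case_nat t x) = lborel_pow (Suc k)"
proof (rule lborel_product.PiM_eqI)
  fix A :: "nat \<Rightarrow> real set" assume "\<And>i. i \<in> {..<Suc k} \<Longrightarrow> A i \<in> sets lborel"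
  then have A: "A i \<in> sets lborel" if "i \<le> k" for i using that by auto
  have vimage: "(\<lambda>(x, t). case_nat t x) -` (Pi\<^sub>E {..<Suc k} A) \<inter> space (lborel_pow k \<Otimes>\<^sub>M lborel)
      = Pi\<^sub>E {..<k} (A \<circ> Suc) \<times> A 0"
    by (auto simp: space_pair_measure space_PiM PiE_iff extensional_def split: nat.splits)
  have "emeasure (distr (lborel_pow k \<Otimes>\<^sub>M lborel) (lborel_pow (Suc k)) (\<lambda>(x, t). case_nat t x))
      (Pi\<^sub>E {..<Suc k} A) = emeasure (lborel_pow k \<Otimes>\<^sub>M lborel) (Pi\<^sub>E {..<k} (A \<circ> Suc) \<times> A 0)"
    using A by (subst emeasure_distr) (auto simp only: vimage intro!: sets_PiM_I_finite measurable_case_nat_lborel_pow)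
  also have "\<dots> = emeasure (lborel_pow k) (Pi\<^sub>E {..<k} (A \<circ> Suc)) * emeasure lborel (A 0)"
    using A by (intro lborel.emeasure_pair_measure_Times) (auto intro!: sets_PiM_I_finite)
  also have "\<dots> = (\<Prod>i<k. emeasure lborel (A (Suc i))) * emeasure lborel (A 0)"
    using A by (subst lborel_product.emeasure_PiM) auto
  also have "\<dots> = (\<Prod>i<Suc k. emeasure lborel (A i))"
    by (subst prod.lessThan_Suc_shift) (simp add: mult.commute)
  finally show "emeasure (distr (lborel_pow k \<Otimes>\<^sub>M lborel) (lborel_pow (Suc k)) (\<lambda>(x, t). case_nat t x))
      (Pi\<^sub>E {..<Suc k} A) = (\<Prod>i<Suc k. emeasure lborel (A i))" .
qed auto

lemma AE_sections:
  assumes "AE z in lborel_pow (Suc k). Q z"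
  shows "AE x in lborel_pow k. AE t in lborel. Q (case_nat t x)"
proof -
  have "AE p in lborel_pow k \<Otimes>\<^sub>M lborel. Q (case p of (x, t) \<Rightarrow> case_nat t x)"
    using assms by (subst (asm) distr_case_nat_lborel_pow[symmetric])
      (rule AE_distrD[OF measurable_case_nat_lborel_pow])
  from pair_sigma_finite.AE_pair[OF pair_sigma_finite_lborel_pow this] show ?thesis by simp
qed

text \<open>A null set \<open>N\<close> of tails pulls back to the cylinder over \<open>N\<close>,
  whose measure is 0 times infinity, that is 0.\<close>

lemma AE_tail:
  assumes "AE x in lborel_pow k. Q x"
  shows "AE z in lborel_pow (Suc k). Q (z \<circ> Suc)"
proof -
  from assms obtain N where N: "N \<in> null_sets (lborel_pow k)" "{x \<in> space (lborel_pow k). \<not> Q x} \<subseteq> N"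
    unfolding eventually_ae_filter by auto
  let ?N = "(\<lambda>z. z \<circ> Suc) -` N \<inter> space (lborel_pow (Suc k))"
  have N': "?N \<in> sets (lborel_pow (Suc k))"
    using N(1) by (intro measurable_sets[OF measurable_tail_lborel_pow]) auto
  have vimage: "(\<lambda>(x, t). case_nat t x) -` ?N \<inter> space (lborel_pow k \<Otimes>\<^sub>M lborel) = N \<times> UNIV"
    using sets.sets_into_space[of N "lborel_pow k"] N(1) case_nat_in_space[of _ k]
    by (auto simp: space_pair_measure comp_def null_sets_def)
  have "emeasure (lborel_pow (Suc k)) ?N = emeasure (lborel_pow k \<Otimes>\<^sub>M lborel) (N \<times> (UNIV :: real set))"
    by (subst distr_case_nat_lborel_pow[symmetric], subst emeasure_distr[OF measurable_case_nat_lborel_pow N'])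
      (simp only: vimage)
  also have "\<dots> = 0"
    using N(1) by (subst lborel.emeasure_pair_measure_Times) auto
  finally have "?N \<in> null_sets (lborel_pow (Suc k))" using N' by auto
  moreover have "{z \<in> space (lborel_pow (Suc k)). \<not> Q (z \<circ> Suc)} \<subseteq> ?N"
    using N(2) measurable_space[OF measurable_tail_lborel_pow] by blast
  ultimately show ?thesis unfolding eventually_ae_filter by blast
qed

section \<open>Completed measures\<close>

text \<open>Preimages under \<open>f\<close> and \<open>g\<close> differ only inside a null set, and
  the completion contains every subset of a null set.\<close>

lemma borel_measurable_completion_AE:
  fixes f g :: "'a \<Rightarrow> real"
  assumes f: "f \<in> borel_measurable M" and eq: "AE x in M. g x = f x"
  shows "g \<in> borel_measurable (completion M)"
proof (rule measurableI)
  fix A :: "real set" assume "A \<in> sets borel"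
  with f have "f -` A \<inter> space M \<in> sets M" by (rule measurable_sets)
  moreover have "AE x in completion M. x \<in> f -` A \<inter> space M \<longleftrightarrow> x \<in> g -` A \<inter> space M"
    using AE_completion[OF eq] by eventually_elim auto
  ultimately show "g -` A \<inter> space (completion M) \<in> sets (completion M)"
    using completion.in_sets_AE[of "f -` A \<inter> space M" "g -` A \<inter> space M" M]
    by auto
qed auto

lemma integral_completion_AE:
  fixes f g :: "'a \<Rightarrow> real"
  assumes f: "f \<in> borel_measurable M" and eq: "AE x in M. g x = f x"
  shows "integral\<^sup>L (completion M) g = integral\<^sup>L M f"
    and "integrable (completion M) g \<longleftrightarrow> integrable M f"
proof -
  note g = borel_measurable_completion_AE[OF f eq]
  have "integral\<^sup>L (completion M) g = integral\<^sup>L (completion M) f"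
    using AE_completion[OF eq] by (intro integral_cong_AE g measurable_completion f)
  with integral_completion[OF f] show "integral\<^sup>L (completion M) g = integral\<^sup>L M f" by simp
  have "integrable (completion M) g \<longleftrightarrow> integrable (completion M) f"
    using AE_completion[OF eq] by (intro integrable_cong_AE g measurable_completion f)
  with integrable_completion[OF f] show "integrable (completion M) g \<longleftrightarrow> integrable M f" by simp
qed

text \<open>Every section of a Borel function is measurable, whereas a Lebesgue measurable function
  may have exceptional sections. Arguments about sections therefore run on a Borel version.\<close>

lemma leb_pow_borel_version:
  fixes f :: "(nat \<Rightarrow> real) \<Rightarrow> real"
  assumes "f \<in> borel_measurable (leb_pow n)"
  obtains f' where "f' \<in> borel_measurable (lborel_pow n)" "AE x in lborel_pow n. f x = f' x"
  using completion_ex_borel_measurable_real[OF assms[unfolded leb_pow_def]] that by blast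

lemma integrable_mult_bounded:
  fixes f g :: "'a \<Rightarrow> real"
  assumes "integrable M f" "g \<in> borel_measurable M" "\<And>x. x \<in> space M \<Longrightarrow> \<bar>g x\<bar> \<le> B"
  shows "integrable M (\<lambda>x. f x * g x)"
proof (rule Bochner_Integration.integrable_bound)
  show "integrable M (\<lambda>x. f x * B)" using assms(1) by simp
  show "AE x in M. norm (f x * g x) \<le> norm (f x * B)"
    using assms(3) by (intro AE_I2) (force simp: abs_mult intro: mult_left_mono)
qed (use assms in measurable)

text \<open>Fubini is applied to a Borel version \<open>f'\<close>. The result carries over because
  almost every section of \<open>f\<close> agrees almost everywhere with that of
  \<open>f'\<close>.\<close>

lemma Fubini_proj_first:
  assumes f: "integrable (leb_pow (Suc k)) f"
  shows "integrable (leb_pow k) (proj_first f)"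
    and "integral\<^sup>L (leb_pow k) (proj_first f) = integral\<^sup>L (leb_pow (Suc k)) f"
proof -
  let ?c = "\<lambda>(x, t). case_nat t x :: nat \<Rightarrow> real"
  obtain f' where f': "f' \<in> borel_measurable (lborel_pow (Suc k))"
    and eq: "AE z in lborel_pow (Suc k). f z = f' z"
    using leb_pow_borel_version[OF borel_measurable_integrable[OF f]] .
  define p where "p x = (\<integral>t. f' (case_nat t x) \<partial>lborel)" for x
  have int: "integrable (lborel_pow (Suc k)) f'"
    using f integral_completion_AE(2)[OF f' eq] by (simp add: leb_pow_def)
  then have int2: "integrable (lborel_pow k \<Otimes>\<^sub>M lborel) (\<lambda>q. f' (?c q))"
    by (subst (asm) distr_case_nat_lborel_pow[symmetric])
      (rule integrable_distr[OF measurable_case_nat_lborel_pow])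
  have p: "integrable (lborel_pow k) p"
    using pair_sigma_finite.integrable_fst'[OF pair_sigma_finite_lborel_pow int2] by (simp add: p_def[abs_def])
  have "integral\<^sup>L (lborel_pow (Suc k)) f' = integral\<^sup>L (lborel_pow k \<Otimes>\<^sub>M lborel) (\<lambda>q. f' (?c q))"
    by (subst distr_case_nat_lborel_pow[symmetric]) (rule integral_distr[OF measurable_case_nat_lborel_pow f'])
  also have "\<dots> = integral\<^sup>L (lborel_pow k) p"
    using pair_sigma_finite.integral_fst'[OF pair_sigma_finite_lborel_pow int2] by (simp add: p_def[abs_def])
  finally have integral_eq: "integral\<^sup>L (lborel_pow (Suc k)) f' = integral\<^sup>L (lborel_pow k) p" .
  \<comment> \<open>\<open>lebesgue\<close> is the completion of \<open>lborel\<close>, so sections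
    that agree almost everywhere have equal integrals, the default value 0 for non-integrable
    sections included.\<close>
  have proj: "AE x in lborel_pow k. proj_first f x = p x"
    using AE_sections[OF eq] AE_space
  proof eventually_elim
    case (elim x)
    have "(\<lambda>t. f' (case_nat t x)) \<in> borel_measurable lborel"
      using measurable_compose[OF measurable_Pair1'[OF elim(2)] measurable_compose[OF measurable_case_nat_lborel_pow f']]
      by simp
    from integral_completion_AE(1)[OF this elim(1)] show ?case
      by (simp add: proj_first_def p_def)
  qed
  have p_meas: "p \<in> borel_measurable (lborel_pow k)" using p by auto
  show "integrable (leb_pow k) (proj_first f)"
    using integral_completion_AE(2)[OF p_meas proj] p by (simp add: leb_pow_def)
  show "integral\<^sup>L (leb_pow k) (proj_first f) = integral\<^sup>L (leb_pow (Suc k)) f"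
    using integral_completion_AE(1)[OF p_meas proj] integral_completion_AE(1)[OF f' eq] integral_eq
    by (simp add: leb_pow_def)
qed

lemma measurable_tail_leb_pow:
  fixes h :: "(nat \<Rightarrow> real) \<Rightarrow> real"
  assumes "h \<in> borel_measurable (leb_pow k)"
  shows "(\<lambda>z. h (z \<circ> Suc)) \<in> borel_measurable (leb_pow (Suc k))"
proof -
  obtain h' where h': "h' \<in> borel_measurable (lborel_pow k)" "AE x in lborel_pow k. h x = h' x"
    using leb_pow_borel_version[OF assms] .
  show ?thesis unfolding leb_pow_def
    by (rule borel_measurable_completion_AE[OF measurable_compose[OF measurable_tail_lborel_pow h'(1)] AE_tail[OF h'(2)]])
qed

section \<open>The essential supremum over the first coordinate\<close>

text \<open>The \<open>AE\<close> quantifier makes sense for non-measurable sections too, so the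
  bounds required by \<open>Phi\<close> can be proved at every \<open>x\<close>. For bounded
  \<open>g\<close> the set is nonempty and bounded below, so \<open>Inf\<close> is a genuine
  infimum.\<close>

definition ess_sup_first :: "((nat \<Rightarrow> real) \<Rightarrow> real) \<Rightarrow> (nat \<Rightarrow> real) \<Rightarrow> real" where
  "ess_sup_first g x = Inf {c. AE t in lborel. g (case_nat t x) \<le> c}"

lemma AE_lborel_ex:
  assumes "AE t in (lborel :: real measure). Q t"
  shows "\<exists>t. Q t"
proof (rule ccontr)
  assume "\<nexists>t. Q t"
  with assms have "AE t in (lborel :: real measure). False" by simp
  then show False by (simp add: AE_iff_null null_sets_def)
qed

context
  fixes g :: "(nat \<Rightarrow> real) \<Rightarrow> real" and a b :: real and x :: "nat \<Rightarrow> real"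
  assumes bounds: "\<And>t. g (case_nat t x) \<in> {a..b}"
begin

lemma upper_bound_in_ess_bounds: "b \<in> {c. AE t in lborel. g (case_nat t x) \<le> c}"
  using bounds by auto

text \<open>The line is not a null set, so some \<open>t\<close> satisfies the bound, and there
  \<open>g\<close> is at least \<open>a\<close>.\<close>

lemma ess_bound_ge:
  assumes "AE t in lborel. g (case_nat t x) \<le> c" shows "a \<le> c"
  using AE_lborel_ex[OF assms] bounds by (auto intro: order_trans)

lemma bdd_below_ess_bounds: "bdd_below {c. AE t in lborel. g (case_nat t x) \<le> c}"
  using ess_bound_ge by (auto simp: bdd_below_def)

lemma ess_sup_first_le:
  assumes "AE t in lborel. g (case_nat t x) \<le> c" shows "ess_sup_first g x \<le> c"
  unfolding ess_sup_first_def using assms bdd_below_ess_bounds by (auto intro: cInf_lower)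

text \<open>Restricting to rational \<open>q\<close> will exhibit the sublevel sets of
  \<open>ess_sup_first g\<close> as countable unions.\<close>

lemma ess_sup_first_less_iff:
  "ess_sup_first g x < c \<longleftrightarrow> (\<exists>q\<in>\<rat>. q < c \<and> (AE t in lborel. g (case_nat t x) \<le> q))"
proof
  assume "ess_sup_first g x < c"
  then obtain d where d: "d < c" "AE t in lborel. g (case_nat t x) \<le> d"
    unfolding ess_sup_first_def using upper_bound_in_ess_bounds bdd_below_ess_bounds
    by (subst (asm) cInf_less_iff) auto
  obtain q where "q \<in> \<rat>" "d < q" "q < c" using Rats_dense_in_real[OF d(1)] by auto
  moreover have "AE t in lborel. g (case_nat t x) \<le> q"
    using d(2) \<open>d < q\<close> by (auto elim!: eventually_mono)
  ultimately show "\<exists>q\<in>\<rat>. q < c \<and> (AE t in lborel. g (case_nat t x) \<le> q)" by blast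
qed (auto dest: ess_sup_first_le)

text \<open>The infimum is attained: each bound exceeding it by 1/(m+1) fails only on a null set,
  and countably many null sets have a null union.\<close>

lemma AE_le_ess_sup_first: "AE t in lborel. g (case_nat t x) \<le> ess_sup_first g x"
proof -
  have "AE t in lborel. g (case_nat t x) \<le> ess_sup_first g x + inverse (real (Suc m))" for m
    using ess_sup_first_less_iff[of "ess_sup_first g x + inverse (real (Suc m))"]
    by (auto elim!: eventually_mono)
  then have "AE t in lborel. \<forall>m. g (case_nat t x) \<le> ess_sup_first g x + inverse (real (Suc m))"
    by (simp add: AE_all_countable)
  then show ?thesis
  proof eventually_elim
    case (elim t)
    show ?case
    proof (rule field_le_epsilon)
      fix e :: real assume "0 < e"
      then obtain m where "inverse (real (Suc m)) < e" using reals_Archimedean by blast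
      with elim[rule_format, of m] show "g (case_nat t x) \<le> ess_sup_first g x + e" by linarith
    qed
  qed
qed

end

lemma ess_sup_first_borel_measurable:
  assumes g: "g \<in> borel_measurable (lborel_pow (Suc k))"
    and bounds: "\<And>z. g z \<in> {a..b}"
  shows "ess_sup_first g \<in> borel_measurable (lborel_pow k)"
proof (rule borel_measurableI_less)
  fix c
  have "{x \<in> space (lborel_pow k). AE t in lborel. g (case_nat t x) \<le> q} \<in> sets (lborel_pow k)" for q
  proof -
    \<comment> \<open>\<open>q\<close> is an essential bound at \<open>x\<close> exactly when the
      section of \<open>Q\<close> at \<open>x\<close> has measure 0, and the measure of the sections
      of a measurable set depends measurably on \<open>x\<close>.\<close>
    define Q where "Q = {p \<in> space (lborel_pow k \<Otimes>\<^sub>M lborel). q < g (case p of (x, t) \<Rightarrow> case_nat t x)}"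
    have Q: "Q \<in> sets (lborel_pow k \<Otimes>\<^sub>M lborel)"
      unfolding Q_def
      using measurable_compose[OF measurable_case_nat_lborel_pow g] by (intro borel_measurable_less) auto
    have "(AE t in lborel. g (case_nat t x) \<le> q) \<longleftrightarrow> emeasure lborel (Pair x -` Q) = 0"
      if "x \<in> space (lborel_pow k)" for x
      using that sets_Pair1[OF Q, of x]
      by (subst AE_iff_measurable[of "Pair x -` Q"]) (auto simp: Q_def space_pair_measure not_le)
    then have "{x \<in> space (lborel_pow k). AE t in lborel. g (case_nat t x) \<le> q}
      = {x \<in> space (lborel_pow k). emeasure lborel (Pair x -` Q) = 0}" by auto
    also have "\<dots> \<in> sets (lborel_pow k)"
      using lborel.measurable_emeasure_Pair[OF Q] by measurable
    finally show ?thesis .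
  qed
  moreover have "{x \<in> space (lborel_pow k). ess_sup_first g x < c} =
      (\<Union>q\<in>{q\<in>\<rat>. q < c}. {x \<in> space (lborel_pow k). AE t in lborel. g (case_nat t x) \<le> q})"
    using bounds by (auto simp: ess_sup_first_less_iff[of g _ a b])
  ultimately show "{x \<in> space (lborel_pow k). ess_sup_first g x < c} \<in> sets (lborel_pow k)"
    by (auto intro!: sets.countable_UN'' countable_subset[OF _ countable_rat])
qed

lemma ess_sup_first_measurable:
  assumes g: "g \<in> borel_measurable (leb_pow (Suc k))"
    and bounds: "\<And>z. z \<in> space (leb_pow (Suc k)) \<Longrightarrow> g z \<in> {a..b}"
  shows "ess_sup_first g \<in> borel_measurable (leb_pow k)"
proof -
  obtain g' where g': "g' \<in> borel_measurable (lborel_pow (Suc k))"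
    and eq: "AE z in lborel_pow (Suc k). g z = g' z"
    using leb_pow_borel_version[OF g] .
  \<comment> \<open>The Borel version \<open>g'\<close> obeys the bounds only almost everywhere.
    Clamping it makes them hold everywhere; this uses \<open>a \<le> b\<close>, obtained by
    evaluating \<open>g\<close> at the zero tuple.\<close>
  define g'' where "g'' z = max a (min b (g' z))" for z
  have "a \<le> b"
    using bounds[of "\<lambda>i\<in>{..<Suc k}. 0"] by (auto simp: leb_pow_def space_PiM)
  have g'': "g'' \<in> borel_measurable (lborel_pow (Suc k))"
    unfolding g''_def using g' by measurable
  have "AE z in lborel_pow (Suc k). g z = g'' z"
    using eq AE_space
  proof eventually_elim
    case (elim z)
    with bounds[of z] show ?case by (auto simp: g''_def leb_pow_def)
  qed
  from AE_sections[OF this] have "AE x in lborel_pow k. ess_sup_first g x = ess_sup_first g'' x"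
  proof eventually_elim
    case (elim x)
    \<comment> \<open>Functions that agree almost everywhere have the same essential bounds.\<close>
    have "(AE t in lborel. g (case_nat t x) \<le> c) \<longleftrightarrow> (AE t in lborel. g'' (case_nat t x) \<le> c)" for c
      by (rule eventually_cong[OF elim]) simp
    then show ?case by (simp add: ess_sup_first_def)
  qed
  with \<open>a \<le> b\<close> show ?thesis unfolding leb_pow_def
    by (intro borel_measurable_completion_AE[OF ess_sup_first_borel_measurable[OF g'', of a b]])
      (auto simp: g''_def)
qed

section \<open>The induction step\<close>

text \<open>Subtracting 1 brings the upper bound k+1 down to k, and truncation at 0 restores
  nonnegativity.\<close>

definition lower_first :: "((nat \<Rightarrow> real) \<Rightarrow> real) \<Rightarrow> (nat \<Rightarrow> real) \<Rightarrow> real" where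
  "lower_first g x = max (ess_sup_first g x - 1) 0"

lemma hamming_dist_case_nat:
  "hamming_dist (Suc k) (case_nat t x) (case_nat s y) = (if t \<noteq> s then 1 else 0) + hamming_dist k x y"
  unfolding hamming_dist_def by (subst sum.lessThan_Suc_shift) simp

lemma hamming_dist_self [simp]: "hamming_dist k x x = 0"
  by (simp add: hamming_dist_def)

lemma hamming_dist_commute: "hamming_dist k x y = hamming_dist k y x"
  unfolding hamming_dist_def by (intro sum.cong) auto

context
  fixes g k
  assumes g: "g \<in> Phi (Suc k)"
begin

lemma Phi_bounds_case_nat:
  assumes "x \<in> space (leb_pow k)" shows "g (case_nat t x) \<in> {0..real (Suc k)}"
  using g assms case_nat_in_space[of x k t] by (auto simp: Phi_def leb_pow_def)

lemma Phi_Lipschitz_case_nat: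
  assumes "x \<in> space (leb_pow k)" "y \<in> space (leb_pow k)"
  shows "\<bar>g (case_nat t x) - g (case_nat s y)\<bar> \<le> (if t \<noteq> s then 1 else 0) + hamming_dist k x y"
  using g assms case_nat_in_space[of x k t] case_nat_in_space[of y k s]
  unfolding hamming_dist_case_nat[symmetric] by (auto simp: Phi_def leb_pow_def)

text \<open>Points over \<open>x\<close> and \<open>y\<close> are compared at the same first
  coordinate \<open>t\<close>, which then adds nothing to the Hamming distance.\<close>

lemma ess_sup_first_Lipschitz:
  assumes x: "x \<in> space (leb_pow k)" and y: "y \<in> space (leb_pow k)"
  shows "ess_sup_first g x \<le> ess_sup_first g y + hamming_dist k x y"
proof (rule ess_sup_first_le[of g x, OF Phi_bounds_case_nat[OF x]])
  show "AE t in lborel. g (case_nat t x) \<le> ess_sup_first g y + hamming_dist k x y"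
    using AE_le_ess_sup_first[of g y, OF Phi_bounds_case_nat[OF y]]
  proof eventually_elim
    case (elim t)
    with Phi_Lipschitz_case_nat[OF x y, of t t] show ?case by simp
  qed
qed

lemma lower_first_in_Phi: "lower_first g \<in> Phi k"
proof -
  have "ess_sup_first g \<in> borel_measurable (leb_pow k)"
    using g by (intro ess_sup_first_measurable[of _ _ 0 "real (Suc k)"]) (auto simp: Phi_def)
  then have "lower_first g \<in> borel_measurable (leb_pow k)"
    unfolding lower_first_def[abs_def] by measurable
  moreover have "lower_first g x \<in> {0..real k}" if "x \<in> space (leb_pow k)" for x
    using ess_sup_first_le[of g x, OF Phi_bounds_case_nat[OF that], of "real (Suc k)"]
      Phi_bounds_case_nat[OF that] by (auto simp: lower_first_def)
  moreover have "\<bar>lower_first g x - lower_first g y\<bar> \<le> hamming_dist k x y"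
    if "x \<in> space (leb_pow k)" "y \<in> space (leb_pow k)" for x y
    using ess_sup_first_Lipschitz[OF that] ess_sup_first_Lipschitz[OF that(2,1)]
    by (auto simp: lower_first_def hamming_dist_commute[of k y x])
  ultimately show ?thesis by (auto simp: Phi_def)
qed

text \<open>With s the essential supremum, g \<le> s for almost every \<open>t\<close> and h \<ge> s
  - 1 give the upper bound 1. Changing the first coordinate moves \<open>g\<close> by at most 1, so
  g \<ge> s - 1 for every \<open>t\<close>; together with g \<ge> 0 this gives g \<ge> h.\<close>

lemma AE_lower_first_diff:
  assumes x: "x \<in> space (leb_pow k)"
  shows "AE t in lborel. g (case_nat t x) - lower_first g x \<in> {0..1}"
  using AE_le_ess_sup_first[of g x, OF Phi_bounds_case_nat[OF x]]
proof eventually_elim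
  case (elim t)
  have "g (case_nat s x) \<le> g (case_nat t x) + 1" for s
    using Phi_Lipschitz_case_nat[OF x x, of s t] by (auto split: if_splits)
  then have "ess_sup_first g x \<le> g (case_nat t x) + 1"
    by (intro ess_sup_first_le[of g x, OF Phi_bounds_case_nat[OF x]]) simp
  with elim Phi_bounds_case_nat[OF x, of t] show ?case by (auto simp: lower_first_def)
qed

lemma integral_mult_le_proj_first:
  assumes f: "integrable (leb_pow (Suc k)) f"
  shows "(\<integral>z. f z * g z \<partial>leb_pow (Suc k))
    \<le> (\<integral>x. proj_first f x * lower_first g x \<partial>leb_pow k) + (\<integral>z. max (f z) 0 \<partial>leb_pow (Suc k))"
proof -
  let ?h = "\<lambda>z. lower_first g (z \<circ> Suc)"
  have h: "lower_first g \<in> borel_measurable (leb_pow k)"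
    and h_bounds: "\<And>x. x \<in> space (leb_pow k) \<Longrightarrow> lower_first g x \<in> {0..real k}"
    using lower_first_in_Phi by (auto simp: Phi_def)
  have tail: "z \<circ> Suc \<in> space (leb_pow k)" if "z \<in> space (leb_pow (Suc k))" for z
    using that measurable_space[OF measurable_tail_lborel_pow] by (auto simp: leb_pow_def)
  have fg: "integrable (leb_pow (Suc k)) (\<lambda>z. f z * g z)"
    using f g by (intro integrable_mult_bounded[of _ _ _ "real (Suc k)"]) (auto simp: Phi_def)
  have fh: "integrable (leb_pow (Suc k)) (\<lambda>z. f z * ?h z)"
    using f h_bounds[OF tail]
    by (intro integrable_mult_bounded[of _ _ _ "real k"] measurable_tail_leb_pow h) auto
  have fp: "integrable (leb_pow (Suc k)) (\<lambda>z. max (f z) 0)"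
    using f by auto
  let ?D = "\<lambda>z. f z * g z - f z * ?h z - max (f z) 0"
  \<comment> \<open>The bounds on g - h are known for each \<open>x\<close> and almost every
    \<open>t\<close>. Integrating over \<open>t\<close> first uses them in this form, with no
    almost-everywhere statement on the product. A non-integrable section contributes the default
    value 0, which also satisfies the inequality.\<close>
  have "proj_first ?D x \<le> 0" if x: "x \<in> space (leb_pow k)" for x
  proof -
    have "AE t in lebesgue. 0 \<le> - ?D (case_nat t x)"
      using AE_completion[OF AE_lower_first_diff[OF x]]
    proof eventually_elim
      case (elim t)
      let ?r = "g (case_nat t x) - lower_first g x"
      \<comment> \<open>Nonnegativity of \<open>?r\<close> allows \<open>f\<close> to be replaced by
        its positive part; \<open>?r\<close> \<le> 1 then removes the factor.\<close>
      have "f (case_nat t x) * ?r \<le> max (f (case_nat t x)) 0 * ?r"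
        using elim by (intro mult_right_mono) auto
      also have "\<dots> \<le> max (f (case_nat t x)) 0 * 1"
        using elim by (intro mult_left_mono) auto
      finally show ?case by (simp add: comp_def algebra_simps)
    qed
    from integral_nonneg_AE[OF this] show ?thesis
      unfolding proj_first_def Bochner_Integration.integral_minus by linarith
  qed
  then have "integral\<^sup>L (leb_pow k) (\<lambda>x. - proj_first ?D x) \<ge> 0"
    by (intro integral_nonneg_AE) auto
  then have "integral\<^sup>L (leb_pow (Suc k)) ?D \<le> 0"
    using fg fh fp by (subst Fubini_proj_first(2)[symmetric]) auto
  then have "(\<integral>z. f z * g z \<partial>leb_pow (Suc k))
    \<le> (\<integral>z. f z * ?h z \<partial>leb_pow (Suc k)) + (\<integral>z. max (f z) 0 \<partial>leb_pow (Suc k))"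
    using fg fh fp by simp
  also have "(\<integral>z. f z * ?h z \<partial>leb_pow (Suc k)) = integral\<^sup>L (leb_pow k) (proj_first (\<lambda>z. f z * ?h z))"
    by (rule Fubini_proj_first(2)[OF fh, symmetric])
  \<comment> \<open>\<open>?h\<close> does not depend on the first coordinate and leaves the
    integral as a constant; for non-integrable sections of \<open>f\<close> both sides are
    0.\<close>
  also have "proj_first (\<lambda>z. f z * ?h z) = (\<lambda>x. proj_first f x * lower_first g x)"
    by (simp add: proj_first_def fun_eq_iff comp_def)
  finally show ?thesis .
qed

end

theorem theorem3p4:
  fixes n :: nat and f g :: "(nat \<Rightarrow> real) \<Rightarrow> real"
  assumes "n \<ge> 1"
    and "integrable (leb_pow n) f"
    and "g \<in> Phi n"
  shows "(\<integral>x. f x * g x \<partial>leb_pow n) \<le> Psi n f"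
  using assms(2,3)
proof (induction n arbitrary: f g)
  \<comment> \<open>Starting at 0 makes the base case trivial: members of \<open>Phi 0\<close> take
    values in [0,0], so the integrand vanishes.\<close>
  case 0
  then have "(\<integral>x. f x * g x \<partial>leb_pow 0) = (\<integral>x. 0 \<partial>leb_pow 0)"
    by (intro Bochner_Integration.integral_cong) (auto simp: Phi_def)
  then show ?case by simp
next
  case (Suc k)
  show ?case
    \<comment> \<open>The integral of the positive part is exactly the summand that
      \<open>Psi\<close> adds at stage \<open>Suc k\<close>.\<close>
    using integral_mult_le_proj_first[OF Suc.prems(2,1)]
      Suc.IH[OF Fubini_proj_first(1)[OF Suc.prems(1)] lower_first_in_Phi[OF Suc.prems(2)]]
    by simp
qed

end
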